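(* Let $k\ge 2$ be an integer and let $a,d\in\mathbb{N}^2$ be linearly independent over $\mathbb{Q}$ such that $\{a,a+d,\ldots,a+kd\}$ is a minimal generating set of $S_{a,d,k}=\langle a,a+d,\ldots,a+kd\rangle$. Let $b\in\mathbb{N}^2$ with $b\notin S_{a,d,k}$ and such that some positive integer multiple of $b$ lies in $S_{a,d,k}$. Let $\mu$ be the smallest positive integer such that $\mu b\in S_{a,d,k}$, and suppose that $\mu b=\sum_{i=1}^{k+1}\lambda_i(a+(i-1)d)$ with $\lambda_i\in\mathbb{N}$ such that $\lambda_1$ or $\lambda_{k+1}$ is non-zero. Let $S_{a,d,k}^b=\langle a,a+d,\ldots,a+kd,b\rangle$. Then $$\mathrm{QF}(S_{a,d,k}^b)=\{(\mu-1)b-(a+id)\mid 1\le i\le k-1\}.$$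
   Context: $\mathbb{N}$ denotes the set of non-negative integers. $\langle a_1,\ldots,a_n\rangle=\{\sum_i\lambda_i a_i\mid \lambda_i\in\mathbb{N}\}$ is the affine semigroup generated by $a_1,\ldots,a_n\in\mathbb{N}^r$. For an affine semigroup $S$ and a set $E$ of nonzero elements of $S$, the Apery set is $\mathrm{Ap}(S,E)=\{s\in S\mid s-e\notin S\text{ for all }e\in E\}$. Put $x\preceq_S y$ iff $y-x\in S$. The semigroup $S=S_{a,d,k}^b$ is regarded as a simplicial affine semigroup in $\mathbb{N}^2$ with respect to the extremal rays $a$ and $a+kd$; with $E=\{a,a+kd\}$, its set of quasi-Frobenius elements is $\mathrm{QF}(S)=\{s-(a+(a+kd))\mid s\in\max_{\preceq_S}\mathrm{Ap}(S,E)\}$, where $\max_{\preceq_S}$ denotes the set of maximal elements. *)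

theory Defs
  imports "HOL-Analysis.Cartesian_Space"
begin

text \<open>Vectors of \<open>\<nat>\<^sup>r\<close> are elements of \<open>int ^ 'n\<close> with non-negative entries, so that the differences
  in the definitions of the Apery set, of the order of a semigroup and of the quasi-Frobenius
  elements are genuine (untruncated) differences.\<close>

definition nat_vecs :: "(int ^ 'n) set" where
  "nat_vecs = {x. \<forall>i. 0 \<le> x $ i}"

text \<open>Only meant for finite \<open>A\<close>.\<close>

definition affine_semigroup :: "(int ^ 'n) set \<Rightarrow> (int ^ 'n) set" where
  "affine_semigroup A = {\<Sum>x\<in>A. int (c x) *s x | c :: int ^ 'n \<Rightarrow> nat. True}"

definition minimal_generating_set :: "(int ^ 'n) set \<Rightarrow> (int ^ 'n) set \<Rightarrow> bool" where
  "minimal_generating_set A S \<longleftrightarrow>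
     affine_semigroup A = S \<and> (\<forall>B. B \<subset> A \<longrightarrow> affine_semigroup B \<noteq> S)"

definition apery :: "(int ^ 'n) set \<Rightarrow> (int ^ 'n) set \<Rightarrow> (int ^ 'n) set" where
  "apery S E = {s \<in> S. \<forall>e\<in>E. s - e \<notin> S}"

definition sg_le :: "(int ^ 'n) set \<Rightarrow> int ^ 'n \<Rightarrow> int ^ 'n \<Rightarrow> bool" where
  "sg_le S x y \<longleftrightarrow> y - x \<in> S"

definition sg_maximal :: "(int ^ 'n) set \<Rightarrow> (int ^ 'n) set \<Rightarrow> (int ^ 'n) set" where
  "sg_maximal S X = {x \<in> X. \<forall>y\<in>X. sg_le S x y \<longrightarrow> y = x}"

text \<open>Quasi-Frobenius elements of a simplicial affine semigroup \<open>S\<close> in \<open>\<nat>\<^sup>2\<close> with respect to the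
  generators \<open>e\<^sub>1\<close>, \<open>e\<^sub>2\<close> of its two extremal rays.\<close>

definition quasi_Frobenius :: "(int ^ 2) set \<Rightarrow> int ^ 2 \<Rightarrow> int ^ 2 \<Rightarrow> (int ^ 2) set" where
  "quasi_Frobenius S e\<^sub>1 e\<^sub>2 = {s - (e\<^sub>1 + e\<^sub>2) | s. s \<in> sg_maximal S (apery S {e\<^sub>1, e\<^sub>2})}"

text \<open>The library predicate speaks about sets of vectors; \<open>x \<noteq> y\<close> makes this the linear independence
  of the pair \<open>x, y\<close>.\<close>

definition rat_vec :: "int ^ 'n \<Rightarrow> rat ^ 'n" where
  "rat_vec x = (\<chi> i. of_int (x $ i))"

definition rat_lin_indep :: "int ^ 'n \<Rightarrow> int ^ 'n \<Rightarrow> bool" where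
  "rat_lin_indep x y \<longleftrightarrow> x \<noteq> y \<and> vec.independent {rat_vec x, rat_vec y}"

definition arith_gens :: "int ^ 'n \<Rightarrow> int ^ 'n \<Rightarrow> nat \<Rightarrow> (int ^ 'n) set" where
  "arith_gens a d k = {a + int i *s d | i. i \<le> k}"

end

theory Submission imports Defs begin

text \<open>The set \<open>T\<close> of all \<open>n a + m d\<close> with integers \<open>0 \<le> m \<le> k n\<close> is the semigroup generated by
  \<open>a, a + d, \<dots>, a + k d\<close>, so it consists of all points of the lattice
  \<open>G = \<int> a + \<int> d\<close> in the cone spanned by \<open>a\<close> and \<open>a + k d\<close>
  (\<open>generated_arith_gens\<close>). As a multiple of \<open>b\<close> lies in that cone, \<open>b\<close> does too; hence a positive
  multiple of \<open>b\<close> lies in \<open>T\<close> as soon as it lies in \<open>G\<close>, and \<open>\<mu>\<close> is the order of \<open>b\<close> modulo \<open>G\<close>.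

  Therefore \<open>S = \<langle>T, b\<rangle>\<close> is the disjoint union of the translates \<open>j b + T\<close> for \<open>0 \<le> j < \<mu>\<close>, which
  lie in distinct cosets of \<open>G\<close> (\<open>elt_in_S_iff\<close>). Subtracting \<open>a\<close> or \<open>a + k d\<close> stays in the same
  coset, so the Apery set of \<open>S\<close> is the union of the translates \<open>j b + A\<close>, where
  \<open>A = {0, a + d, \<dots>, a + (k - 1) d}\<close> is the Apery set of \<open>T\<close> (\<open>apery_eq\<close>).

  In this set one can still add \<open>b\<close> if \<open>j < \<mu> - 1\<close>, and \<open>a + d\<close> to \<open>j b\<close>. The elements
  \<open>(\<mu> - 1) b + a + i d\<close> with \<open>0 < i < k\<close> remain. They are maximal: reaching an element
  \<open>j b + t\<close> with \<open>j < \<mu> - 1\<close> by adding an element of \<open>S\<close> means passing \<open>\<mu> b\<close>, whose coefficient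
  of \<open>a\<close> is positive and would have to be compensated by \<open>t \<in> A\<close>; in the last coset, the
  difference to \<open>(\<mu> - 1) b\<close> has a negative coefficient of \<open>a\<close>, and two of the elements themselves
  differ by a multiple of \<open>d\<close>, which is in \<open>T\<close> only if it is \<open>0\<close> (\<open>maximal_apery_eq\<close>).
  Subtracting \<open>2 a + k d\<close> and replacing \<open>i\<close> by \<open>k - i\<close> gives the quasi-Frobenius elements.\<close>

section \<open>Finitely generated affine semigroups\<close>

lemma affine_semigroupI: "x = (\<Sum>z\<in>A. int (c z) *s z) \<Longrightarrow> x \<in> affine_semigroup A"
  unfolding affine_semigroup_def by blast

lemma zero_in_affine_semigroup: "0 \<in> affine_semigroup A"
  by (rule affine_semigroupI[where c = "\<lambda>_. 0"]) simp

lemma add_in_affine_semigroup: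
  assumes "x \<in> affine_semigroup A" "y \<in> affine_semigroup A"
  shows "x + y \<in> affine_semigroup A"
proof -
  obtain c e where "x = (\<Sum>z\<in>A. int (c z) *s z)" "y = (\<Sum>z\<in>A. int (e z) *s z)"
    using assms unfolding affine_semigroup_def by blast
  then show ?thesis
    by (intro affine_semigroupI[where c = "\<lambda>z. c z + e z"])
       (simp add: sum.distrib vector_sadd_rdistrib)
qed

lemma generator_in_affine_semigroup:
  assumes "finite A" "x \<in> A"
  shows "x \<in> affine_semigroup A"
proof (rule affine_semigroupI[where c = "\<lambda>z. if z = x then 1 else 0"])
  have "(\<Sum>z\<in>A. int (if z = x then 1 else 0) *s z) = (\<Sum>z\<in>A. if z = x then z else 0)"
    by (rule sum.cong) auto
  also have "\<dots> = x"
    using assms by simp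
  finally show "x = (\<Sum>z\<in>A. int (if z = x then 1 else 0) *s z)" ..
qed

lemma nat_mult_closed:
  assumes "0 \<in> T" "\<And>x y. x \<in> T \<Longrightarrow> y \<in> T \<Longrightarrow> x + y \<in> T" "x \<in> T"
  shows "int n *s x \<in> T"
proof (induction n)
  case 0
  then show ?case using assms(1) by simp
next
  case (Suc n)
  have "int (Suc n) *s x = x + int n *s x"
    by (simp add: vec_eq_iff algebra_simps)
  then show ?case using Suc assms by simp
qed

lemma affine_semigroup_least:
  assumes "0 \<in> T" "\<And>x y. x \<in> T \<Longrightarrow> y \<in> T \<Longrightarrow> x + y \<in> T" "A \<subseteq> T"
  shows "affine_semigroup A \<subseteq> T"
proof
  fix x assume "x \<in> affine_semigroup A"
  then obtain c where x: "x = (\<Sum>z\<in>A. int (c z) *s z)"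
    unfolding affine_semigroup_def by blast
  have "B \<subseteq> A \<Longrightarrow> (\<Sum>z\<in>B. int (c z) *s z) \<in> T" for B
  proof (induction B rule: infinite_finite_induct)
    case (insert y B)
    then show ?case using assms nat_mult_closed[OF assms(1,2)] by (simp add: subset_iff)
  qed (use assms in auto)
  then show "x \<in> T" using x by blast
qed

lemma affine_semigroup_insert:
  assumes "finite A"
  shows "affine_semigroup (insert b A) = {s + int j *s b | s j. s \<in> affine_semigroup A}"
    (is "_ = ?T")
proof
  show "affine_semigroup (insert b A) \<subseteq> ?T"
  proof (rule affine_semigroup_least)
    have "(0::int^'a) = 0 + int 0 *s b" by simp
    then show "0 \<in> ?T" using zero_in_affine_semigroup by blast
  next
    fix x y assume "x \<in> ?T" "y \<in> ?T"
    then obtain s j t i where "x = s + int j *s b" "s \<in> affine_semigroup A"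
      "y = t + int i *s b" "t \<in> affine_semigroup A" by blast
    moreover from this have "x + y = (s + t) + int (j + i) *s b"
      by (simp add: vec_eq_iff algebra_simps)
    ultimately show "x + y \<in> ?T" using add_in_affine_semigroup by blast
  next
    have "b = 0 + int 1 *s b" by simp
    then have "b \<in> ?T" using zero_in_affine_semigroup by blast
    moreover have "x \<in> ?T" if "x \<in> A" for x
    proof -
      have "x = x + int 0 *s b" by simp
      then show ?thesis using generator_in_affine_semigroup[OF assms that] by blast
    qed
    ultimately show "insert b A \<subseteq> ?T" by blast
  qed
next
  have "affine_semigroup A \<subseteq> affine_semigroup (insert b A)"
    using assms
    by (intro affine_semigroup_least zero_in_affine_semigroup add_in_affine_semigroup)
       (auto intro: generator_in_affine_semigroup)
  moreover have "int j *s b \<in> affine_semigroup (insert b A)" for j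
    using assms by (intro nat_mult_closed zero_in_affine_semigroup add_in_affine_semigroup)
       (auto intro: generator_in_affine_semigroup)
  ultimately show "?T \<subseteq> affine_semigroup (insert b A)"
    using add_in_affine_semigroup by blast
qed

text \<open>A point with \<open>0 \<le> m \<le> k n\<close> and \<open>n > 0\<close> stays in the set after subtracting the generator
  \<open>a + min(m, k) d\<close>, which lowers \<open>n\<close> by one; conversely the inequalities are additive.\<close>

lemma generated_arith_gens:
  assumes "k > 0"
  shows "affine_semigroup (arith_gens a d k) = {n *s a + m *s d | n m. 0 \<le> m \<and> m \<le> int k * n}"
    (is "_ = ?T")
proof
  show "affine_semigroup (arith_gens a d k) \<subseteq> ?T"
  proof (rule affine_semigroup_least)
    have "(0::int^'a) = 0 *s a + 0 *s d" by simp
    then show "0 \<in> ?T" by fastforce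
  next
    fix x y assume "x \<in> ?T" "y \<in> ?T"
    then obtain n m n' m' where "x = n *s a + m *s d" "y = n' *s a + m' *s d"
      and range: "0 \<le> m" "m \<le> int k * n" "0 \<le> m'" "m' \<le> int k * n'" by blast
    then have "x + y = (n + n') *s a + (m + m') *s d"
      by (simp add: vec_eq_iff algebra_simps)
    moreover have "0 \<le> m + m'" "m + m' \<le> int k * (n + n')"
      using range by (auto simp: algebra_simps)
    ultimately show "x + y \<in> ?T" by blast
  next
    show "arith_gens a d k \<subseteq> ?T"
    proof
      fix x assume "x \<in> arith_gens a d k"
      then obtain i where "i \<le> k" "x = 1 *s a + int i *s d"
        unfolding arith_gens_def by auto
      then show "x \<in> ?T" by fastforce
    qed
  qed
next
  have fin: "finite (arith_gens a d k)"
    unfolding arith_gens_def by simp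
  have point: "int n *s a + int m *s d \<in> affine_semigroup (arith_gens a d k)" if "m \<le> k * n" for n m
    using that
  proof (induction n arbitrary: m)
    case 0
    then show ?case by (simp add: zero_in_affine_semigroup)
  next
    case (Suc n)
    let ?i = "min m k"
    have "a + int ?i *s d \<in> affine_semigroup (arith_gens a d k)"
      by (rule generator_in_affine_semigroup[OF fin]) (auto simp: arith_gens_def)
    moreover have "int n *s a + int (m - ?i) *s d \<in> affine_semigroup (arith_gens a d k)"
      using Suc.prems by (intro Suc.IH) auto
    moreover have "int (Suc n) *s a + int m *s d
        = (a + int ?i *s d) + (int n *s a + int (m - ?i) *s d)"
      by (simp add: vec_eq_iff algebra_simps of_nat_diff)
    ultimately show ?case using add_in_affine_semigroup by metis
  qed
  show "?T \<subseteq> affine_semigroup (arith_gens a d k)"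
  proof
    fix x assume "x \<in> ?T"
    then obtain n m where x: "x = n *s a + m *s d" and range: "0 \<le> m" "m \<le> int k * n" by blast
    have "0 \<le> int k * n"
      using range by linarith
    then have "0 \<le> n"
      using assms by (simp add: zero_le_mult_iff)
    then have "m = int (nat m)" "n = int (nat n)" using range by auto
    moreover from this have "nat m \<le> k * nat n"
      using range by (metis of_nat_le_iff of_nat_mult)
    ultimately show "x \<in> affine_semigroup (arith_gens a d k)"
      using point x by metis
  qed
qed

section \<open>The Apery set of an arithmetic semigroup with one further generator\<close>

text \<open>The minimality of \<open>\<mu>\<close> enters in the form that \<open>\<mu>\<close> is the order of \<open>b\<close> modulo the lattice
  \<open>\<int> a + \<int> d\<close>, which is what separates the translates \<open>j b + T\<close>.\<close>

locale arith_extension =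
  fixes a d b :: "int ^ 'n" and k \<mu> :: nat and N M :: int
  assumes k_ge: "k \<ge> 2"
    and indep: "\<And>n m. n *s a + m *s d = 0 \<Longrightarrow> n = 0 \<and> m = 0"
    and b_nz: "b \<noteq> 0"
    and mu_pos: "\<mu> > 0"
    and mu_mult: "int \<mu> *s b = N *s a + M *s d"
    and mu_range: "0 \<le> M" "M \<le> int k * N"
    and mu_order: "\<And>j n m. j *s b = n *s a + m *s d \<Longrightarrow> int \<mu> dvd j"
begin

definition S :: "(int ^ 'n) set" where
  "S = affine_semigroup (insert b (arith_gens a d k))"

definition elt :: "int \<Rightarrow> int \<Rightarrow> int \<Rightarrow> int ^ 'n" where
  "elt j n m = j *s b + n *s a + m *s d"

lemma elt_diff: "elt j n m - elt j' n' m' = elt (j - j') (n - n') (m - m')"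
  by (simp add: elt_def vec_eq_iff algebra_simps)

lemma elt_shift: "elt (j + q * int \<mu>) n m = elt j (n + q * N) (m + q * M)"
proof -
  have "elt (j + q * int \<mu>) n m = elt j n m + q *s (int \<mu> *s b)"
    by (simp add: elt_def vec_eq_iff algebra_simps)
  also have "\<dots> = elt j (n + q * N) (m + q * M)"
    unfolding mu_mult by (simp add: elt_def vec_eq_iff algebra_simps)
  finally show ?thesis .
qed

lemma elt_eqD:
  assumes "elt j n m = elt j' n' m'"
  obtains q where "j' = j + q * int \<mu>" "n = n' + q * N" "m = m' + q * M"
proof -
  have "(j' - j) *s b = (n - n') *s a + (m - m') *s d"
    using assms by (simp add: elt_def vec_eq_iff algebra_simps)
  then have "int \<mu> dvd j' - j"
    by (rule mu_order)
  then obtain q where q: "j' = j + q * int \<mu>"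
    by (metis add_diff_cancel_left' diff_add_cancel dvd_def mult.commute add.commute)
  then have "elt j n m = elt j (n' + q * N) (m' + q * M)"
    using assms elt_shift by simp
  then have "(n - (n' + q * N)) *s a + (m - (m' + q * M)) *s d = 0"
    by (simp add: elt_def vec_eq_iff algebra_simps)
  then have "n = n' + q * N" "m = m' + q * M"
    using indep by force+
  then show ?thesis using q that by blast
qed

lemma N_pos: "N > 0"
proof (rule ccontr)
  assume "\<not> N > 0"
  then have "int k * N \<le> 0"
    by (simp add: mult_nonneg_nonpos)
  then have "M = 0" "int k * N = 0"
    using mu_range by linarith+
  then have "M = 0" "N = 0"
    using k_ge by auto
  then have "int \<mu> *s b = 0"
    using mu_mult by simp
  then show False
    using mu_pos b_nz by (auto simp: vec_eq_iff)
qed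

lemma mem_S_iff_ex:
  "x \<in> S \<longleftrightarrow> (\<exists>j n m. x = elt j n m \<and> 0 \<le> j \<and> 0 \<le> m \<and> m \<le> int k * n)"
proof -
  have fin: "finite (arith_gens a d k)"
    unfolding arith_gens_def by simp
  have "k > 0" using k_ge by simp
  have "x \<in> S \<longleftrightarrow> (\<exists>s j. x = s + int j *s b \<and> s \<in> affine_semigroup (arith_gens a d k))"
    unfolding S_def affine_semigroup_insert[OF fin] by blast
  also have "\<dots> \<longleftrightarrow> (\<exists>j n m. x = elt (int j) n m \<and> 0 \<le> m \<and> m \<le> int k * n)"
  proof -
    have elt: "elt (int j) n m = (n *s a + m *s d) + int j *s b" for j n m
      by (simp add: elt_def algebra_simps)
    show ?thesis
      unfolding generated_arith_gens[OF \<open>k > 0\<close>] elt by blast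
  qed
  also have "\<dots> \<longleftrightarrow> (\<exists>j n m. x = elt j n m \<and> 0 \<le> j \<and> 0 \<le> m \<and> m \<le> int k * n)"
    by (metis nonneg_int_cases of_nat_0_le_iff)
  finally show ?thesis .
qed

text \<open>Two representations with exponents \<open>j\<close> and \<open>j'\<close> of \<open>b\<close> differ by a multiple \<open>q\<close> of the
  relation \<open>\<mu> b = N a + M d\<close>. If \<open>0 \<le> j < \<mu>\<close> and \<open>j' \<ge> 0\<close>, then \<open>q \<ge> 0\<close>, and since
  \<open>N a + M d\<close> satisfies the cone inequalities, they pass from \<open>j'\<close> to \<open>j\<close>.\<close>

lemma elt_in_S_iff:
  assumes "0 \<le> j" "j < int \<mu>"
  shows "elt j n m \<in> S \<longleftrightarrow> 0 \<le> m \<and> m \<le> int k * n"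
proof
  assume "elt j n m \<in> S"
  then obtain j' n' m' where eq: "elt j n m = elt j' n' m'"
    and range: "0 \<le> j'" "0 \<le> m'" "m' \<le> int k * n'"
    unfolding mem_S_iff_ex by blast
  from eq obtain q where q: "j' = j + q * int \<mu>" "n = n' + q * N" "m = m' + q * M"
    by (rule elt_eqD)
  have "q \<ge> 0"
  proof (rule ccontr)
    assume "\<not> q \<ge> 0"
    then have "q * int \<mu> \<le> (-1) * int \<mu>"
      by (intro mult_right_mono) auto
    then show False using q(1) range(1) assms by simp
  qed
  then have "0 \<le> q * M" "q * M \<le> q * (int k * N)"
    using mu_range by (auto intro: mult_left_mono)
  then show "0 \<le> m \<and> m \<le> int k * n"
    using q range by (auto simp: algebra_simps)
next
  assume "0 \<le> m \<and> m \<le> int k * n"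
  then show "elt j n m \<in> S"
    using assms unfolding mem_S_iff_ex by blast
qed

lemma mem_S_canonical:
  assumes "x \<in> S"
  obtains j n m where "x = elt j n m" "0 \<le> j" "j < int \<mu>" "0 \<le> m" "m \<le> int k * n"
proof -
  obtain i n m where x: "x = elt i n m"
    using assms unfolding mem_S_iff_ex by blast
  let ?q = "i div int \<mu>" and ?j = "i mod int \<mu>"
  have "x = elt ?j (n + ?q * N) (m + ?q * M)"
    using elt_shift[of ?j ?q n m] x by simp
  moreover have "0 \<le> ?j" "?j < int \<mu>"
    using mu_pos by auto
  ultimately show ?thesis
    using that elt_in_S_iff assms by metis
qed

lemma elt_inj:
  assumes "elt j n m = elt j' n' m'" "0 \<le> j" "j < int \<mu>" "0 \<le> j'" "j' < int \<mu>"
  shows "j = j'" "n = n'" "m = m'"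
proof -
  obtain q where q: "j' = j + q * int \<mu>" "n = n' + q * N" "m = m' + q * M"
    using assms(1) by (rule elt_eqD)
  then have "j' mod int \<mu> = j mod int \<mu>"
    by simp
  then show "j = j'"
    using assms by simp
  then have "q = 0"
    using q(1) mu_pos by simp
  then show "n = n'" "m = m'"
    using q by auto
qed

text \<open>Within the coset of \<open>j b\<close> the two Apery conditions exclude \<open>m \<le> k (n - 1)\<close> and \<open>m \<ge> k\<close>. Hence
  \<open>k (n - 1) < k\<close>, which leaves \<open>n = 0\<close> and \<open>n = 1\<close>.\<close>

lemma apery_eq:
  "apery S {a, a + int k *s d} =
     {elt j n m | j n m. 0 \<le> j \<and> j < int \<mu> \<and> (n = 0 \<and> m = 0 \<or> n = 1 \<and> 0 < m \<and> m < int k)}"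
    (is "_ = ?A")
proof -
  have a: "a = elt 0 1 0" and akd: "a + int k *s d = elt 0 1 (int k)"
    by (auto simp: elt_def)
  have iff: "elt j n m \<in> apery S {a, a + int k *s d} \<longleftrightarrow>
      n = 0 \<and> m = 0 \<or> n = 1 \<and> 0 < m \<and> m < int k"
    if j: "0 \<le> j" "j < int \<mu>" for j n m
  proof -
    have "elt j n m \<in> apery S {a, a + int k *s d} \<longleftrightarrow>
        elt j n m \<in> S \<and> elt j (n - 1) m \<notin> S \<and> elt j (n - 1) (m - int k) \<notin> S"
      unfolding apery_def akd by (subst a) (simp add: elt_diff)
    also have "\<dots> \<longleftrightarrow> (0 \<le> m \<and> m \<le> int k * n) \<and> \<not> m \<le> int k * n - int k \<and> \<not> int k \<le> m"
      unfolding elt_in_S_iff[OF j] by (auto simp: algebra_simps)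
    also have "\<dots> \<longleftrightarrow> n = 0 \<and> m = 0 \<or> n = 1 \<and> 0 < m \<and> m < int k"
    proof
      assume range: "(0 \<le> m \<and> m \<le> int k * n) \<and> \<not> m \<le> int k * n - int k \<and> \<not> int k \<le> m"
      then have "int k * n < int k * 2" "0 \<le> int k * n"
        using k_ge by linarith+
      then have "n < 2" "0 \<le> n"
        using k_ge by (simp_all add: zero_le_mult_iff)
      then have "n = 0 \<or> n = 1" by auto
      then show "n = 0 \<and> m = 0 \<or> n = 1 \<and> 0 < m \<and> m < int k"
        using range by auto
    qed (use k_ge in auto)
    finally show ?thesis .
  qed
  show ?thesis
  proof (rule set_eqI)
    fix x
    show "x \<in> apery S {a, a + int k *s d} \<longleftrightarrow> x \<in> ?A"
    proof
      assume x: "x \<in> apery S {a, a + int k *s d}"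
      then have "x \<in> S" unfolding apery_def by blast
      then obtain j n m where "x = elt j n m" "0 \<le> j" "j < int \<mu>"
        by (rule mem_S_canonical)
      then show "x \<in> ?A" using x iff by blast
    next
      assume "x \<in> ?A"
      then show "x \<in> apery S {a, a + int k *s d}" using iff by blast
    qed
  qed
qed

lemma maximal_apery_eq:
  "sg_maximal S (apery S {a, a + int k *s d}) = {elt (int \<mu> - 1) 1 m | m. 0 < m \<and> m < int k}"
    (is "?L = ?R")
proof
  let ?A = "apery S {a, a + int k *s d}"
  show "?L \<subseteq> ?R"
  proof
    fix x assume "x \<in> ?L"
    then have "x \<in> ?A" and max: "\<And>y. y \<in> ?A \<Longrightarrow> y - x \<in> S \<Longrightarrow> y = x"
      unfolding sg_maximal_def sg_le_def by auto
    then obtain j n m where x: "x = elt j n m" and j: "0 \<le> j" "j < int \<mu>"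
      and nm: "n = 0 \<and> m = 0 \<or> n = 1 \<and> 0 < m \<and> m < int k"
      unfolding apery_eq by blast
    have "j = int \<mu> - 1"
    proof (rule ccontr)
      assume "j \<noteq> int \<mu> - 1"
      then have "elt (j + 1) n m \<in> ?A"
        using j nm unfolding apery_eq by force
      moreover have "elt (j + 1) n m - x \<in> S"
        unfolding x elt_diff mem_S_iff_ex by force
      ultimately have "elt (j + 1) n m = x" by (rule max)
      then show False
        using elt_inj(1)[of "j + 1" n m j n m] j \<open>j \<noteq> int \<mu> - 1\<close> x by simp
    qed
    moreover have "n = 1"
    proof (rule ccontr)
      assume "n \<noteq> 1"
      then have "n = 0" "m = 0" using nm by auto
      have "elt j 1 1 \<in> ?A"
        using j k_ge unfolding apery_eq by force
      moreover have "elt j 1 1 - x \<in> S"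
        using mu_pos k_ge by (simp add: x elt_diff elt_in_S_iff \<open>n = 0\<close> \<open>m = 0\<close>)
      ultimately have "elt j 1 1 = x" by (rule max)
      then show False
        using elt_inj(2)[of j 1 1 j n m] j \<open>n = 0\<close> x by simp
    qed
    ultimately show "x \<in> ?R" using x nm by auto
  qed
  show "?R \<subseteq> ?L"
  proof
    fix x assume "x \<in> ?R"
    then obtain m where x: "x = elt (int \<mu> - 1) 1 m" and m: "0 < m" "m < int k" by blast
    have "x \<in> ?A"
      using m mu_pos unfolding x apery_eq by force
    moreover have "y = x" if "y \<in> ?A" "y - x \<in> S" for y
    proof -
      obtain j n' m' where y: "y = elt j n' m'" and j: "0 \<le> j" "j < int \<mu>"
        and nm: "n' = 0 \<and> m' = 0 \<or> n' = 1 \<and> 0 < m' \<and> m' < int k"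
        using \<open>y \<in> ?A\<close> unfolding apery_eq by blast
      have diff: "elt (j - (int \<mu> - 1)) (n' - 1) (m' - m) \<in> S"
        using that(2) by (simp add: x y elt_diff)
      show ?thesis
      proof (cases "j = int \<mu> - 1")
        case True
        then have "0 \<le> m' - m" "m' - m \<le> int k * (n' - 1)"
          using diff mu_pos by (auto simp: elt_in_S_iff)
        then have "n' = 1" "m' = m" using nm m by auto
        then show ?thesis using True x y by simp
      next
        \<comment> \<open>Replacing the negative exponent \<open>j - \<mu> + 1\<close> of \<open>b\<close> by \<open>j + 1\<close> subtracts \<open>N > 0\<close> from the
          coefficient of \<open>a\<close>, which becomes negative.\<close>
        case False
        have "elt (j - (int \<mu> - 1)) (n' - 1) (m' - m) = elt (j + 1) (n' - 1 - N) (m' - m - M)"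
          using elt_shift[of "j + 1" "-1" "n' - 1" "m' - m"] by (simp add: algebra_simps)
        then have "elt (j + 1) (n' - 1 - N) (m' - m - M) \<in> S"
          using diff by simp
        then have "0 \<le> int k * (n' - 1 - N)"
          using False j by (auto simp: elt_in_S_iff)
        then have "0 \<le> n' - 1 - N"
          using k_ge by (auto simp: zero_le_mult_iff)
        then show ?thesis
          using nm N_pos by auto
      qed
    qed
    ultimately show "x \<in> ?L"
      unfolding sg_maximal_def sg_le_def by blast
  qed
qed

end

section \<open>The quasi-Frobenius elements\<close>

lemma rat_lin_indep_int_combination:
  assumes "rat_lin_indep a d" "n *s a + m *s d = 0"
  shows "n = 0 \<and> m = 0"
proof (rule ccontr)
  assume nz: "\<not> (n = 0 \<and> m = 0)"
  let ?V = "{rat_vec a, rat_vec d}"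
  have ne: "rat_vec a \<noteq> rat_vec d"
    using assms(1) by (auto simp: rat_lin_indep_def rat_vec_def vec_eq_iff)
  define u :: "rat ^ 'a \<Rightarrow> rat" where
    "u = (\<lambda>v. if v = rat_vec a then of_int n else of_int m)"
  have "(\<Sum>v\<in>?V. u v *s v) = rat_vec (n *s a + m *s d)"
    using ne by (auto simp: u_def rat_vec_def vec_eq_iff)
  also have "\<dots> = 0"
    unfolding assms(2) by (simp add: rat_vec_def vec_eq_iff)
  finally have "(\<Sum>v\<in>?V. u v *s v) = 0" .
  moreover have "\<exists>v\<in>?V. u v \<noteq> 0"
    using nz ne by (auto simp: u_def)
  ultimately have "vec.dependent ?V"
    by (subst vec.dependent_finite) auto
  then show False
    using assms(1) unfolding rat_lin_indep_def by blast
qed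

text \<open>A multiple \<open>j b\<close> lying in the lattice \<open>\<int> a + \<int> d\<close> reduces to \<open>r b\<close> with \<open>r = j mod \<mu>\<close>. If
  \<open>r > 0\<close>, then comparing \<open>\<mu> (r b)\<close> with \<open>r (\<mu> b)\<close> shows that the coordinates of \<open>r b\<close> are a
  positive multiple of those of \<open>\<mu> b\<close>, hence satisfy the cone inequalities. So \<open>r b\<close> would be in
  the semigroup, against the minimality of \<open>\<mu>\<close>.\<close>

lemma least_multiple_dvd:
  fixes a d b :: "int ^ 'n" and k \<mu> :: nat
  assumes k: "k > 0"
    and indep: "\<And>n m. n *s a + m *s d = 0 \<Longrightarrow> n = 0 \<and> m = 0"
    and pos: "\<mu> > 0"
    and mult: "int \<mu> *s b = N *s a + M *s d"
    and range: "0 \<le> M" "M \<le> int k * N"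
    and least: "\<And>r. r > 0 \<Longrightarrow> int r *s b \<in> affine_semigroup (arith_gens a d k) \<Longrightarrow> \<mu> \<le> r"
    and j: "j *s b = n *s a + m *s d"
  shows "int \<mu> dvd j"
proof (rule ccontr)
  assume not_dvd: "\<not> int \<mu> dvd j"
  define q r where "q = j div int \<mu>" and "r = j mod int \<mu>"
  define n' m' where "n' = n - q * N" and "m' = m - q * M"
  have "r \<noteq> 0" "0 \<le> r" "r < int \<mu>"
    using not_dvd pos unfolding r_def dvd_eq_mod_eq_0 by simp_all
  then have r: "0 < r" "r < int \<mu>"
    by linarith+
  have j_eq: "j = q * int \<mu> + r"
    unfolding q_def r_def by simp
  have "r *s b = j *s b - q *s (int \<mu> *s b)"
    unfolding j_eq by (simp add: vec_eq_iff algebra_simps)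
  also have "\<dots> = n' *s a + m' *s d"
    unfolding j mult n'_def m'_def by (simp add: vec_eq_iff algebra_simps)
  finally have rb: "r *s b = n' *s a + m' *s d" .
  have "(int \<mu> * n' - r * N) *s a + (int \<mu> * m' - r * M) *s d
      = int \<mu> *s (n' *s a + m' *s d) - r *s (N *s a + M *s d)"
    by (simp add: vec_eq_iff algebra_simps)
  also have "\<dots> = 0"
    unfolding rb[symmetric] mult[symmetric] by (simp add: vec_eq_iff algebra_simps)
  finally have "int \<mu> * n' - r * N = 0 \<and> int \<mu> * m' - r * M = 0"
    by (rule indep)
  then have coords: "int \<mu> * n' = r * N" "int \<mu> * m' = r * M"
    by auto
  have "0 \<le> int \<mu> * m'"
    using coords(2) r range by simp
  then have "0 \<le> m'"
    using pos by (simp add: zero_le_mult_iff)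
  have "int \<mu> * m' \<le> r * (int k * N)"
    using coords(2) r range by simp
  also have "\<dots> = int \<mu> * (int k * n')"
    using coords(1) by (simp add: algebra_simps)
  finally have "m' \<le> int k * n'"
    using pos by simp
  then have "r *s b \<in> affine_semigroup (arith_gens a d k)"
    using \<open>0 \<le> m'\<close> unfolding generated_arith_gens[OF k] rb by blast
  then have "int (nat r) *s b \<in> affine_semigroup (arith_gens a d k)"
    using r by simp
  then have "\<mu> \<le> nat r"
    using r by (intro least) auto
  then show False
    using r by simp
qed

theorem corollary7p4:
  fixes k \<mu> :: nat and a d b :: "int ^ 2" and l :: "nat \<Rightarrow> nat"
  assumes "k \<ge> 2"
    and "a \<in> nat_vecs" and "d \<in> nat_vecs" and "b \<in> nat_vecs"
    and "rat_lin_indep a d"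
    and "minimal_generating_set (arith_gens a d k) (affine_semigroup (arith_gens a d k))"
    and "b \<notin> affine_semigroup (arith_gens a d k)"
    and "\<exists>m::nat. m > 0 \<and> int m *s b \<in> affine_semigroup (arith_gens a d k)"
    and "\<mu> = (LEAST m::nat. m > 0 \<and> int m *s b \<in> affine_semigroup (arith_gens a d k))"
    and "int \<mu> *s b = (\<Sum>i = 1..k + 1. int (l i) *s (a + (int i - 1) *s d))"
    and "l 1 \<noteq> 0 \<or> l (k + 1) \<noteq> 0"
  shows "quasi_Frobenius (affine_semigroup (insert b (arith_gens a d k))) a (a + int k *s d) =
           {(int \<mu> - 1) *s b - (a + int i *s d) | i::nat. 1 \<le> i \<and> i \<le> k - 1}"
proof -
  let ?T = "affine_semigroup (arith_gens a d k)"
  have k: "k > 0" using assms(1) by simp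
  have indep: "\<And>n m. n *s a + m *s d = 0 \<Longrightarrow> n = 0 \<and> m = 0"
    by (rule rat_lin_indep_int_combination[OF assms(5)])
  have "\<mu> > 0 \<and> int \<mu> *s b \<in> ?T"
    unfolding assms(9) by (rule LeastI_ex[OF assms(8)])
  then have mu: "\<mu> > 0" "int \<mu> *s b \<in> ?T"
    by simp_all
  obtain N M where NM: "int \<mu> *s b = N *s a + M *s d" "0 \<le> M" "M \<le> int k * N"
    using mu(2) unfolding generated_arith_gens[OF k] by blast
  have least: "\<mu> \<le> r" if "r > 0" "int r *s b \<in> ?T" for r
    unfolding assms(9) by (rule Least_le) (use that in blast)
  have "b \<noteq> 0"
    using assms(7) zero_in_affine_semigroup by metis
  interpret arith_extension a d b k \<mu> N M
  proof
    show "int \<mu> dvd j" if "j *s b = n *s a + m *s d" for j n m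
      by (rule least_multiple_dvd[OF k _ mu(1) NM _ that]) (fact indep, fact least)
  qed (fact assms(1), fact indep, fact \<open>b \<noteq> 0\<close>, fact mu(1), fact NM(1), fact NM(2), fact NM(3))
  \<comment> \<open>The index \<open>i\<close> of the claim is \<open>k - m\<close>, as \<open>(a + m d) - (2 a + k d) = -(a + (k - m) d)\<close>.\<close>
  have shift: "elt (int \<mu> - 1) 1 m - (a + (a + int k *s d))
      = (int \<mu> - 1) *s b - (a + (int k - m) *s d)" for m
    by (simp add: elt_def vec_eq_iff algebra_simps)
  have "quasi_Frobenius S a (a + int k *s d)
      = {(int \<mu> - 1) *s b - (a + (int k - m) *s d) | m. 0 < m \<and> m < int k}"
    unfolding quasi_Frobenius_def maximal_apery_eq shift[symmetric] by blast
  also have "\<dots> = {(int \<mu> - 1) *s b - (a + int i *s d) | i::nat. 1 \<le> i \<and> i \<le> k - 1}"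
    (is "?L = ?R")
  proof
    show "?L \<subseteq> ?R"
    proof
      fix x assume "x \<in> ?L"
      then obtain m where m: "x = (int \<mu> - 1) *s b - (a + (int k - m) *s d)" "0 < m" "m < int k"
        by blast
      then have "x = (int \<mu> - 1) *s b - (a + int (nat (int k - m)) *s d)"
        "1 \<le> nat (int k - m)" "nat (int k - m) \<le> k - 1" by auto
      then show "x \<in> ?R" by blast
    qed
    show "?R \<subseteq> ?L"
    proof
      fix x assume "x \<in> ?R"
      then obtain i where i: "x = (int \<mu> - 1) *s b - (a + int i *s d)" "1 \<le> i" "i \<le> k - 1"
        by blast
      then have "x = (int \<mu> - 1) *s b - (a + (int k - (int k - int i)) *s d)"
        "0 < int k - int i" "int k - int i < int k" using k by auto
      then show "x \<in> ?L" by blast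
    qed
  qed
  finally show ?thesis unfolding S_def .
qed

end
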